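(* Let $\lambda/\mu$ be a skew partition and let $i\in\mathbb N_+$. Then there exists an involution $\mathbf B_i:\operatorname{RPP}(\lambda/\mu)\to\operatorname{RPP}(\lambda/\mu)$ which preserves the ceq statistic (i.e. $\operatorname{ceq}(\mathbf B_i(T))=\operatorname{ceq}(T)$ for all $T$) and acts on the ircont statistic by the transposition of its $i$-th and $(i+1)$-th entries (i.e. $\operatorname{ircont}(\mathbf B_i(T))$ is obtained from $\operatorname{ircont}(T)$ by switching its $i$-th and $(i+1)$-th entries, for all $T$).
   Context: $\mathbb N_+=\{1,2,3,\ldots\}$. A weak composition is a sequence $\alpha=(\alpha_1,\alpha_2,\ldots)$ of nonnegative integers with finite sum; a partition is a weakly decreasing weak composition, identified with its Young diagram $\{(i,j)\in\mathbb N_+^2\mid j\le\lambda_i\}$ (matrix/English notation: $i$ is the row, growing downwards; $j$ is the column). A skew partition $\lambda/\mu$ is a pair of partitions with $\mu\subseteq\lambda$; $\lambda/\mu$ also denotes the set difference of the diagrams. A filling of $\lambda/\mu$ is a map $T:\lambda/\mu\to\mathbb N_+$. A reverse plane partition (rpp) of shape $\lambda/\mu$ is a filling whose entries increase weakly from left to right along rows and weakly from top to bottom down columns. $\operatorname{RPP}(\lambda/\mu)$ is the set of all rpps of shape $\lambda/\mu$. For a filling $T$, $\operatorname{ircont}(T)$ is the weak composition $(r_1,r_2,\ldots)$ where $r_i$ is the number of columns of $T$ that contain an entry equal to $i$. $\operatorname{ceq}(T)$ is the weak composition $(c_1,c_2,\ldots)$ where $c_i$ is the number of $j\in\mathbb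 N_+$ such that $(i,j)$ and $(i+1,j)$ are both cells of $\lambda/\mu$ and $T(i,j)=T(i+1,j)$. *)

theory Defs
  imports Main "HOL-Library.FuncSet" "HOL-Combinatorics.Transposition"
begin

text \<open>
  Rows, columns and entries are positive integers, represented by the natural numbers
  \<open>\<ge> 1\<close>. A sequence \<open>(\<alpha>\<^sub>1, \<alpha>\<^sub>2, \<dots>)\<close> is a function on \<^typ>\<open>nat\<close> whose
  unused entry at \<open>0\<close> is fixed to be \<open>0\<close>; sequences then agree iff they are equal functions.
  For nonnegative integers, a finite sum means a finite support.
\<close>

definition weak_composition :: "(nat \<Rightarrow> nat) \<Rightarrow> bool" where
  "weak_composition \<alpha> \<longleftrightarrow> \<alpha> 0 = 0 \<and> finite {i. \<alpha> i \<noteq> 0}"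

definition is_partition :: "(nat \<Rightarrow> nat) \<Rightarrow> bool" where
  "is_partition \<alpha> \<longleftrightarrow> weak_composition \<alpha> \<and> (\<forall>i\<ge>1. \<alpha> (i + 1) \<le> \<alpha> i)"

definition diagram :: "(nat \<Rightarrow> nat) \<Rightarrow> (nat \<times> nat) set" where
  "diagram \<alpha> = {(i, j). i \<ge> 1 \<and> j \<ge> 1 \<and> j \<le> \<alpha> i}"

definition skew_partition :: "(nat \<Rightarrow> nat) \<Rightarrow> (nat \<Rightarrow> nat) \<Rightarrow> bool" where
  "skew_partition \<alpha> \<mu> \<longleftrightarrow> is_partition \<alpha> \<and> is_partition \<mu> \<and> diagram \<mu> \<subseteq> diagram \<alpha>"

definition skew_diagram :: "(nat \<Rightarrow> nat) \<Rightarrow> (nat \<Rightarrow> nat) \<Rightarrow> (nat \<times> nat) set" where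
  "skew_diagram \<alpha> \<mu> = diagram \<alpha> - diagram \<mu>"

text \<open>
  The extensional function space makes two fillings equal iff they agree on all cells.
\<close>

definition fillings :: "(nat \<times> nat) set \<Rightarrow> (nat \<times> nat \<Rightarrow> nat) set" where
  "fillings D = D \<rightarrow>\<^sub>E {1..}"

definition RPP :: "(nat \<times> nat) set \<Rightarrow> (nat \<times> nat \<Rightarrow> nat) set" where
  "RPP D = {T \<in> fillings D.
     (\<forall>i j j'. (i, j) \<in> D \<longrightarrow> (i, j') \<in> D \<longrightarrow> j \<le> j' \<longrightarrow> T (i, j) \<le> T (i, j')) \<and>
     (\<forall>i i' j. (i, j) \<in> D \<longrightarrow> (i', j) \<in> D \<longrightarrow> i \<le> i' \<longrightarrow> T (i, j) \<le> T (i', j))}"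

definition ircont :: "(nat \<times> nat) set \<Rightarrow> (nat \<times> nat \<Rightarrow> nat) \<Rightarrow> nat \<Rightarrow> nat" where
  "ircont D T = (\<lambda>k. card {j. \<exists>i. (i, j) \<in> D \<and> T (i, j) = k})"

definition ceq :: "(nat \<times> nat) set \<Rightarrow> (nat \<times> nat \<Rightarrow> nat) \<Rightarrow> nat \<Rightarrow> nat" where
  "ceq D T = (\<lambda>i. card {j. (i, j) \<in> D \<and> (i + 1, j) \<in> D \<and> T (i, j) = T (i + 1, j)})"

lemma finite_diagram:
  assumes "weak_composition \<alpha>"
  shows "finite (diagram \<alpha>)"
proof -
  have "diagram \<alpha> \<subseteq> (SIGMA i:{i. \<alpha> i \<noteq> 0}. {..\<alpha> i})"
    by (auto simp: diagram_def)
  moreover have "finite (SIGMA i:{i. \<alpha> i \<noteq> 0}. {..\<alpha> i})"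
    using assms by (auto simp: weak_composition_def)
  ultimately show ?thesis
    by (rule finite_subset)
qed

lemma finite_skew_diagram: "skew_partition \<alpha> \<mu> \<Longrightarrow> finite (skew_diagram \<alpha> \<mu>)"
  by (simp add: skew_partition_def is_partition_def skew_diagram_def finite_diagram)

lemma weak_composition_ircont:
  assumes "skew_partition \<alpha> \<mu>" "T \<in> fillings (skew_diagram \<alpha> \<mu>)"
  shows "weak_composition (ircont (skew_diagram \<alpha> \<mu>) T)"
proof -
  let ?D = "skew_diagram \<alpha> \<mu>"
  have "{j. \<exists>i. (i, j) \<in> ?D \<and> T (i, j) = 0} = {}"
    using PiE_mem[OF assms(2)[unfolded fillings_def]] by fastforce
  then have "ircont ?D T 0 = 0"
    unfolding ircont_def by (metis card.empty)
  moreover have "{k. ircont ?D T k \<noteq> 0} \<subseteq> T ` ?D"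
  proof
    fix k assume "k \<in> {k. ircont ?D T k \<noteq> 0}"
    then have "{j. \<exists>i. (i, j) \<in> ?D \<and> T (i, j) = k} \<noteq> {}"
      unfolding ircont_def by (metis (mono_tags, lifting) card.empty mem_Collect_eq)
    then show "k \<in> T ` ?D" by blast
  qed
  ultimately show ?thesis
    using finite_skew_diagram[OF assms(1)]
    by (auto simp: weak_composition_def intro: finite_subset)
qed

lemma weak_composition_ceq:
  assumes "skew_partition \<alpha> \<mu>"
  shows "weak_composition (ceq (skew_diagram \<alpha> \<mu>) T)"
proof -
  let ?D = "skew_diagram \<alpha> \<mu>"
  have "ceq ?D T 0 = 0"
    by (simp add: ceq_def skew_diagram_def diagram_def)
  moreover have "{k. ceq ?D T k \<noteq> 0} \<subseteq> fst ` ?D"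
  proof
    fix k assume "k \<in> {k. ceq ?D T k \<noteq> 0}"
    then have "{j. (k, j) \<in> ?D \<and> (k + 1, j) \<in> ?D \<and> T (k, j) = T (k + 1, j)} \<noteq> {}"
      unfolding ceq_def by (metis (mono_tags, lifting) card.empty mem_Collect_eq)
    then show "k \<in> fst ` ?D" by force
  qed
  ultimately show ?thesis
    using finite_skew_diagram[OF assms]
    by (auto simp: weak_composition_def intro: finite_subset)
qed

end

theory Submission
  imports Defs "HOL-Library.Poly_Mapping" "HOL-Library.Multiset"
begin

text \<open>
  Merging the entries \<open>k + 1\<close> into \<open>k\<close> splits the rpps into classes. Inside a class the cells with merged
  entry \<open>k\<close> form in every column \<open>j\<close> an interval \<open>{s j..<e j}\<close>, where \<open>s\<close> and \<open>e\<close> are weakly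
  decreasing, and an rpp amounts to a weakly decreasing sequence \<open>P\<close> with \<open>s j \<le> P j \<le> e j\<close>, \<open>P j\<close>
  being the first row of column \<open>j\<close> that gets \<open>k + 1\<close>. Both statistics depend only on the class and on
  the multiset of column labels: \<open>Lo\<close> if \<open>P j = e j\<close> (only entries \<open>k\<close>), \<open>Hi\<close> if \<open>P j = s j\<close> (only
  entries \<open>k + 1\<close>), and otherwise \<open>Mixed (P j)\<close>, the case that breaks one vertical equality. It
  therefore suffices that the generating function of the label multisets is symmetric in the weights
  \<open>x\<close> of \<open>Lo\<close> and \<open>y\<close> of \<open>Hi\<close>: then the rpps of a class with a given label multiset are as many as those
  with \<open>Lo\<close> and \<open>Hi\<close> exchanged, and the involution is glued from arbitrary bijections between them. The symmetry is proved column by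
  column, by writing the sum over the \<open>P\<close> that are \<open>\<ge> p\<close> as
  \<open>t - (\<Sum>r<p. z r * b r) - y * b p\<close> with \<open>t\<close> and \<open>b\<close> symmetric in \<open>x\<close> and \<open>y\<close>.
\<close>

subsection \<open>Weakly decreasing sequences between two boundaries\<close>

datatype label = Lo | Hi | Mixed nat

fun swap_label :: "label \<Rightarrow> label" where
  "swap_label Lo = Hi"
| "swap_label Hi = Lo"
| "swap_label (Mixed q) = Mixed q"

lemma swap_label_swap_label [simp]: "swap_label (swap_label a) = a"
  by (cases a) auto

definition label_of :: "nat \<Rightarrow> nat \<Rightarrow> nat \<Rightarrow> label" where
  "label_of s e q = (if q = e then Lo else if q = s then Hi else Mixed q)"

fun weight :: "'a \<Rightarrow> 'a \<Rightarrow> (nat \<Rightarrow> 'a) \<Rightarrow> label \<Rightarrow> 'a" where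
  "weight x y z Lo = x"
| "weight x y z Hi = y"
| "weight x y z (Mixed q) = z q"

definition paths :: "nat set \<Rightarrow> (nat \<Rightarrow> nat) \<Rightarrow> (nat \<Rightarrow> nat) \<Rightarrow> (nat \<Rightarrow> nat) set" where
  "paths J s e = {P \<in> PiE J (\<lambda>j. {s j..e j}). antimono_on J P}"

text \<open>The bound \<open>p\<close> serves the induction on columns: \<open>P\<close> is weakly
  decreasing, so its value in the last column bounds all earlier values from below.\<close>

definition path_sum ::
  "'a::comm_ring_1 \<Rightarrow> 'a \<Rightarrow> (nat \<Rightarrow> 'a) \<Rightarrow> nat set \<Rightarrow> (nat \<Rightarrow> nat) \<Rightarrow> (nat \<Rightarrow> nat) \<Rightarrow> nat \<Rightarrow> 'a" where
  "path_sum x y z J s e p =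
     (\<Sum>P | P \<in> paths J s e \<and> (\<forall>j\<in>J. p \<le> P j). \<Prod>j\<in>J. weight x y z (label_of (s j) (e j) (P j)))"

lemma finite_paths: "finite J \<Longrightarrow> finite (paths J s e)"
  unfolding paths_def by (rule finite_subset[OF Collect_subset]) (auto intro: finite_PiE)

lemma path_sum_empty [simp]: "path_sum x y z {} s e p = 1"
  by (simp add: path_sum_def paths_def monotone_on_def)

lemma path_sum_insert:
  assumes fin: "finite J" and max: "\<And>j. j \<in> J \<Longrightarrow> j < m"
  shows "path_sum x y z (insert m J) s e p =
    (\<Sum>q\<in>{max p (s m)..e m}. weight x y z (label_of (s m) (e m) q) * path_sum x y z J s e q)"
proof -
  have m: "m \<notin> J" using max by blast
  let ?w = "\<lambda>j q. weight x y z (label_of (s j) (e j) q)"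
  let ?A = "{P. P \<in> paths (insert m J) s e \<and> (\<forall>j\<in>insert m J. p \<le> P j)}"
  let ?B = "\<lambda>q. {P. P \<in> paths J s e \<and> (\<forall>j\<in>J. q \<le> P j)}"
  have "(\<Sum>q\<in>{max p (s m)..e m}. ?w m q * path_sum x y z J s e q) =
      (\<Sum>q\<in>{max p (s m)..e m}. \<Sum>P\<in>?B q. ?w m q * (\<Prod>j\<in>J. ?w j (P j)))"
    unfolding path_sum_def by (simp add: sum_distrib_left)
  also have "\<dots> = (\<Sum>(q, P)\<in>(SIGMA q:{max p (s m)..e m}. ?B q). ?w m q * (\<Prod>j\<in>J. ?w j (P j)))"
    by (rule sum.Sigma) (auto intro: finite_subset[OF _ finite_paths[OF fin]])
  also have "\<dots> = (\<Sum>P\<in>?A. \<Prod>j\<in>insert m J. ?w j (P j))"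
  \<comment> \<open>Split off the value at \<open>m\<close>; resetting it to
    \<open>undefined\<close> keeps the rest extensional on \<open>J\<close>.\<close>
  proof (rule sum.reindex_bij_witness[symmetric, where
        i = "\<lambda>(q, P). P(m := q)" and j = "\<lambda>P. (P m, P(m := undefined))"])
    fix P assume P: "P \<in> ?A"
    then have "P m \<le> P j" if "j \<in> J" for j
      using that max[OF that] by (auto simp: paths_def monotone_on_def)
    with P m show "(P m, P(m := undefined)) \<in> (SIGMA q:{max p (s m)..e m}. ?B q)"
      by (auto simp: paths_def monotone_on_def PiE_iff extensional_def)
    have "(\<Prod>j\<in>J. ?w j ((P(m := undefined)) j)) = (\<Prod>j\<in>J. ?w j (P j))"
      using m by (intro prod.cong) auto
    then show "(case (P m, P(m := undefined)) of (q, P) \<Rightarrow> ?w m q * (\<Prod>j\<in>J. ?w j (P j))) =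
      (\<Prod>j\<in>insert m J. ?w j (P j))"
      using fin m by simp
  next
    fix a assume "a \<in> (SIGMA q:{max p (s m)..e m}. ?B q)"
    then obtain q P where a: "a = (q, P)" "q \<in> {max p (s m)..e m}" "P \<in> ?B q" by auto
    then have "P m = undefined" using m by (auto simp: paths_def PiE_iff extensional_def)
    then show "(case a of (q, P) \<Rightarrow> P(m := q)) \<in> ?A"
      "((case a of (q, P) \<Rightarrow> P(m := q)) m, (case a of (q, P) \<Rightarrow> P(m := q))(m := undefined)) = a"
      using a m max
      by (auto simp: paths_def monotone_on_def PiE_iff extensional_def dest: order.trans less_imp_le)
         (meson not_less order_less_imp_le)
  qed auto
  finally show ?thesis by (simp add: path_sum_def)
qed

text \<open>The quantifier order carries the symmetry: one pair \<open>t\<close>, \<open>b\<close>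
  serves both \<open>(u, v)\<close> and \<open>(v, u)\<close>. The vanishing of \<open>b\<close> is
  what the next column of the induction needs.\<close>

lemma path_sum_form:
  fixes u v :: "'a::comm_ring_1" and z :: "nat \<Rightarrow> 'a"
  assumes "finite J" "antimono_on J s" "antimono_on J e" "\<And>j. j \<in> J \<Longrightarrow> s j < e j"
  shows "\<exists>t b. (\<forall>r. (\<forall>j\<in>J. r \<le> s j) \<longrightarrow> b r = 0) \<and>
    (\<forall>(x, y)\<in>{(u, v), (v, u)}. \<forall>p. (\<forall>j\<in>J. p \<le> e j) \<longrightarrow>
      path_sum x y z J s e p = t - (\<Sum>r<p. z r * b r) - y * b p)"
  using assms
proof (induction J rule: finite_linorder_max_induct)
  case empty
  show ?case by (rule exI[of _ 1], rule exI[of _ "\<lambda>_. 0"]) simp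
next
  case (insert m J)
  have "antimono_on J s" "antimono_on J e"
    using insert.prems by (auto simp: monotone_on_def)
  then obtain t b where b0: "\<And>r. (\<forall>j\<in>J. r \<le> s j) \<Longrightarrow> b r = 0" and
    IH: "\<And>x y p. (x, y) \<in> {(u, v), (v, u)} \<Longrightarrow> (\<forall>j\<in>J. p \<le> e j) \<Longrightarrow>
      path_sum x y z J s e p = t - (\<Sum>r<p. z r * b r) - y * b p"
    using insert.IH insert.prems(3) by (smt (verit) case_prodD insertCI)
  \<comment> \<open>With \<open>a\<close>, the induction hypothesis reads
    \<open>a q - y * b q\<close>, and \<open>z q * b q\<close> becomes the difference
    \<open>a q - a (Suc q)\<close>.\<close>
  define a where "a r = t - (\<Sum>i<r. z i * b i)" for r
  define b' where "b' r = (if r \<le> s m then 0 else a r)" for r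
  \<comment> \<open>Obtained by solving the claim at \<open>p = e m\<close>, where the sum is
    \<open>x * (a (e m) - y * b (e m))\<close>: adding \<open>y * a (e m)\<close> leaves the
    symmetric coefficients \<open>u + v\<close> and \<open>u * v\<close>.\<close>
  define t' where "t' = (u + v) * a (e m) - u * v * b (e m) + (\<Sum>r<e m. z r * b' r)"
  have a_Suc: "a (Suc r) = a r - z r * b r" for r by (simp add: a_def)
  have sm: "s m \<le> s j" and em: "e m \<le> e j" if "j \<in> J" for j
    using that insert.prems(1,2) insert.hyps(2) by (auto simp: monotone_on_def less_imp_le)
  have se: "s m < e m" using insert.prems by simp
  \<comment> \<open>Row \<open>s m\<close> itself has weight \<open>y\<close>, so this removes the
    asymmetric term \<open>y * y * b (s m)\<close>.\<close>
  have bs: "b (s m) = 0" using sm b0 by blast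
  have form: "path_sum x y z (insert m J) s e p = t' - (\<Sum>r<p. z r * b' r) - y * b' p"
    if xy: "(x, y) \<in> {(u, v), (v, u)}" and p: "p \<le> e m" for x y p
  proof -
    have V: "path_sum x y z J s e q = a q - y * b q" if "q \<le> e m" for q
      using IH[OF xy, of q] that em by (auto simp: a_def intro: order.trans)
    let ?f = "\<lambda>q. weight x y z (label_of (s m) (e m) q) * path_sum x y z J s e q"
    have S: "path_sum x y z (insert m J) s e p = sum ?f {max p (s m)..e m}" for p
      by (rule path_sum_insert) (use insert.hyps in auto)
    show ?thesis using p
    \<comment> \<open>Downwards from \<open>p = e m\<close>; for \<open>p\<close> at least
      \<open>s m\<close>, a step adds the summand \<open>q = p\<close>.\<close>
    proof (induction rule: inc_induct)
      case base
      have "path_sum x y z (insert m J) s e (e m) = x * (a (e m) - y * b (e m))"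
        using se V[of "e m"] by (simp add: S label_of_def max_def)
      then show ?case using xy se by (auto simp: t'_def b'_def algebra_simps)
    next
      case (step p)
      consider "p < s m" | "p = s m" | "s m < p" by linarith
      then show ?case
      proof cases
        case 1
        then have "path_sum x y z (insert m J) s e p = path_sum x y z (insert m J) s e (Suc p)"
          by (simp add: S max_def)
        with 1 step show ?thesis by (simp add: b'_def)
      next
        case 2
        then have "path_sum x y z (insert m J) s e p = y * a p + path_sum x y z (insert m J) s e (Suc p)"
          using se V[of p] bs by (simp add: S sum.atLeast_Suc_atMost label_of_def)
        with 2 step bs show ?thesis by (simp add: b'_def a_Suc)
      next
        \<comment> \<open>Here
          \<open>z p * (a p - y * b p) = z p * a p + y * (a (Suc p) - a p)\<close>: the first part
          feeds the sum over \<open>b'\<close>, the second telescopes.\<close>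
        case 3
        then have "path_sum x y z (insert m J) s e p =
            z p * (a p - y * b p) + path_sum x y z (insert m J) s e (Suc p)"
          using step.hyps V[of p] by (simp add: S sum.atLeast_Suc_atMost label_of_def max_def)
        moreover have "path_sum x y z (insert m J) s e (Suc p) =
            t' - ((\<Sum>r<p. z r * b' r) + z p * a p) - y * (a p - z p * b p)"
          using 3 step.IH by (simp add: b'_def a_Suc)
        ultimately show ?thesis using 3 by (simp add: b'_def algebra_simps)
      qed
    qed
  qed
  show ?case
    by (rule exI[of _ t'], rule exI[of _ b']) (use form in \<open>auto simp: b'_def\<close>)
qed

text \<open>At \<open>p = 0\<close> the closed form is just \<open>t\<close>, because the sum is
  empty and \<open>b 0 = 0\<close>.\<close>

lemma path_sum_swap:
  assumes "finite J" "antimono_on J s" "antimono_on J e" "\<And>j. j \<in> J \<Longrightarrow> s j < e j"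
  shows "path_sum x y z J s e 0 = path_sum y x z J s e 0"
  using path_sum_form[OF assms, of x y z] by fastforce

section \<open>Counting paths by coefficients of monomials\<close>

definition label_mset :: "nat set \<Rightarrow> (nat \<Rightarrow> nat) \<Rightarrow> (nat \<Rightarrow> nat) \<Rightarrow> (nat \<Rightarrow> nat) \<Rightarrow> label multiset" where
  "label_mset J s e P = image_mset (\<lambda>j. label_of (s j) (e j) (P j)) (mset_set J)"

lemma prod_single:
  "(\<Prod>j\<in>J. Poly_Mapping.single {#f j#} (1::int)) = Poly_Mapping.single (image_mset f (mset_set J)) 1"
proof (induction J rule: infinite_finite_induct)
  case (insert j J)
  then show ?case by (simp add: mult_single)
qed (simp_all add: single_one)

text \<open>Label multisets act as monomials: multiplying them adds the multisets, so a coefficient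
  counts paths. The renaming \<open>g\<close> covers the plain and the exchanged weights at
  once.\<close>

lemma path_sum_single:
  fixes g :: "label \<Rightarrow> label"
  assumes "finite J"
  defines "X \<equiv> (\<lambda>a. Poly_Mapping.single {#g a#} (1::int))"
  shows "Poly_Mapping.lookup (path_sum (X Lo) (X Hi) (\<lambda>q. X (Mixed q)) J s e 0) M =
    int (card {P \<in> paths J s e. image_mset g (label_mset J s e P) = M})"
proof -
  have w: "weight (X Lo) (X Hi) (\<lambda>q. X (Mixed q)) a = X a" for a by (cases a) auto
  have "path_sum (X Lo) (X Hi) (\<lambda>q. X (Mixed q)) J s e 0 =
      (\<Sum>P\<in>paths J s e. Poly_Mapping.single (image_mset g (label_mset J s e P)) 1)"
    unfolding path_sum_def w unfolding X_def prod_single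
    by (simp add: label_mset_def image_mset.compositionality comp_def)
  then show ?thesis
    using finite_paths[OF assms(1)]
    by (simp add: lookup_sum lookup_single when_def sum.If_cases Int_def eq_commute[of M])
qed

lemma card_paths_swap:
  assumes "finite J" "antimono_on J s" "antimono_on J e" "\<And>j. j \<in> J \<Longrightarrow> s j < e j"
  shows "card {P \<in> paths J s e. label_mset J s e P = M} =
    card {P \<in> paths J s e. label_mset J s e P = image_mset swap_label M}"
proof -
  have swap_iff: "image_mset swap_label N = M \<longleftrightarrow> N = image_mset swap_label M" for N
    by (auto simp: image_mset.compositionality comp_def)
  let ?X = "\<lambda>a. Poly_Mapping.single {#a#} (1::int)"
  have "int (card {P \<in> paths J s e. label_mset J s e P = M}) =
      Poly_Mapping.lookup (path_sum (?X Lo) (?X Hi) (\<lambda>q. ?X (Mixed q)) J s e 0) M"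
    using path_sum_single[OF assms(1), of "\<lambda>a. a" s e M] by simp
  also have "\<dots> = Poly_Mapping.lookup (path_sum (?X Hi) (?X Lo) (\<lambda>q. ?X (Mixed q)) J s e 0) M"
    by (simp add: path_sum_swap[OF assms])
  also have "\<dots> = int (card {P \<in> paths J s e. image_mset swap_label (label_mset J s e P) = M})"
    using path_sum_single[OF assms(1), of swap_label s e M] by simp
  finally show ?thesis by (simp add: swap_iff)
qed

subsection \<open>The class of rpps with given merged filling\<close>

text \<open>Stated for arbitrary sets of cells, because the level sets of an rpp inherit this
  property from the skew shape.\<close>

definition convex_cells :: "(nat \<times> nat) set \<Rightarrow> bool" where
  "convex_cells D \<longleftrightarrow> (\<forall>i j i' j' r c. (i, j) \<in> D \<longrightarrow> (i', j') \<in> D \<longrightarrow>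
     i \<le> r \<longrightarrow> r \<le> i' \<longrightarrow> j \<le> c \<longrightarrow> c \<le> j' \<longrightarrow> (r, c) \<in> D)"

lemma convex_cellsD:
  "convex_cells D \<Longrightarrow> (i, j) \<in> D \<Longrightarrow> (i', j') \<in> D \<Longrightarrow>
     i \<le> r \<Longrightarrow> r \<le> i' \<Longrightarrow> j \<le> c \<Longrightarrow> c \<le> j' \<Longrightarrow> (r, c) \<in> D"
  unfolding convex_cells_def by blast

lemma partition_antimono:
  assumes "is_partition \<alpha>" "1 \<le> i" "i \<le> i'"
  shows "\<alpha> i' \<le> \<alpha> i"
  using assms(3,2)
proof (induction rule: dec_induct)
  case (step n)
  then have "\<alpha> (Suc n) \<le> \<alpha> n" using assms(1) by (simp add: is_partition_def)
  with step show ?case by simp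
qed simp

lemma convex_skew_diagram:
  assumes "skew_partition l \<mu>"
  shows "convex_cells (skew_diagram l \<mu>)"
  unfolding convex_cells_def
proof (intro allI impI)
  fix i j i' j' r c
  assume *: "(i, j) \<in> skew_diagram l \<mu>" "(i', j') \<in> skew_diagram l \<mu>"
    "i \<le> r" "r \<le> i'" "j \<le> c" "c \<le> j'"
  then have "1 \<le> i" by (simp add: skew_diagram_def diagram_def)
  then have "l i' \<le> l r" "\<mu> r \<le> \<mu> i"
    using assms *(3,4) partition_antimono[of l r i'] partition_antimono[of \<mu> i r]
    by (simp_all add: skew_partition_def)
  with * show "(r, c) \<in> skew_diagram l \<mu>"
    by (auto simp: skew_diagram_def diagram_def)
qed

lemma RPP_rowD: "T \<in> RPP D \<Longrightarrow> (i, j) \<in> D \<Longrightarrow> (i, j') \<in> D \<Longrightarrow> j \<le> j' \<Longrightarrow> T (i, j) \<le> T (i, j')"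
  and RPP_colD: "T \<in> RPP D \<Longrightarrow> (i, j) \<in> D \<Longrightarrow> (i', j) \<in> D \<Longrightarrow> i \<le> i' \<Longrightarrow> T (i, j) \<le> T (i', j)"
  unfolding RPP_def by blast+

text \<open>Go along the row and then down the column; convexity puts the corner
  \<open>(i, j')\<close> into \<open>D\<close>.\<close>

lemma RPP_mono:
  assumes "T \<in> RPP D" "convex_cells D" "(i, j) \<in> D" "(i', j') \<in> D" "i \<le> i'" "j \<le> j'"
  shows "T (i, j) \<le> T (i', j')"
proof -
  have "(i, j') \<in> D" using convex_cellsD[OF assms(2-4), of i j'] assms(5,6) by simp
  then show ?thesis
    using RPP_rowD[OF assms(1,3) _ assms(6)] RPP_colD[OF assms(1) _ assms(4,5)] by fastforce
qed

section \<open>Merged fillings, and heights as coordinates within a class\<close>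

definition merge :: "nat \<Rightarrow> (nat \<times> nat) set \<Rightarrow> (nat \<times> nat \<Rightarrow> nat) \<Rightarrow> nat \<times> nat \<Rightarrow> nat" where
  "merge k D T = (\<lambda>c\<in>D. if T c = Suc k then k else T c)"

definition level :: "nat \<Rightarrow> (nat \<times> nat) set \<Rightarrow> (nat \<times> nat \<Rightarrow> nat) \<Rightarrow> (nat \<times> nat) set" where
  "level k D S = {c \<in> D. S c = k}"

definition first_row :: "(nat \<times> nat) set \<Rightarrow> nat \<Rightarrow> nat" where
  "first_row R j = Min {r. (r, j) \<in> R}"

definition end_row :: "(nat \<times> nat) set \<Rightarrow> nat \<Rightarrow> nat" where
  "end_row R j = Suc (Max {r. (r, j) \<in> R})"

text \<open>The lower bound fixes the value when the whole column is \<open>Suc k\<close>; with no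
  \<open>Suc k\<close> in the column the value is \<open>end_row R j\<close>, from where on the
  universal condition is vacuous.\<close>

definition height :: "nat \<Rightarrow> (nat \<times> nat) set \<Rightarrow> (nat \<times> nat \<Rightarrow> nat) \<Rightarrow> nat \<Rightarrow> nat" where
  "height k R T j = (LEAST p. first_row R j \<le> p \<and> (\<forall>r. p \<le> r \<longrightarrow> (r, j) \<in> R \<longrightarrow> T (r, j) = Suc k))"

definition split_at :: "nat \<Rightarrow> (nat \<times> nat) set \<Rightarrow> (nat \<times> nat \<Rightarrow> nat) \<Rightarrow> (nat \<Rightarrow> nat) \<Rightarrow> nat \<times> nat \<Rightarrow> nat" where
  "split_at k D S P = (\<lambda>(r, j)\<in>D. if S (r, j) = k \<and> P j \<le> r then Suc k else S (r, j))"

definition labels :: "nat \<Rightarrow> (nat \<times> nat) set \<Rightarrow> (nat \<times> nat \<Rightarrow> nat) \<Rightarrow> label multiset" where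
  "labels k D T = (let R = level k D (merge k D T) in
     label_mset (snd ` R) (first_row R) (end_row R) (height k R T))"

text \<open>The relabelling is weakly monotone, since no integer lies strictly between
  \<open>k\<close> and \<open>Suc k\<close>; \<open>1 \<le> k\<close> keeps the entries
  positive.\<close>

lemma merge_RPP:
  assumes "T \<in> RPP D" "1 \<le> k"
  shows "merge k D T \<in> RPP D"
proof -
  let ?m = "\<lambda>a. if a = Suc k then k else a"
  have mono: "?m a \<le> ?m b" if "a \<le> b" for a b
    using that by auto
  have m: "merge k D T c = ?m (T c)" if "c \<in> D" for c
    using that by (simp add: merge_def)
  have "merge k D T \<in> fillings D"
    using assms by (auto simp: merge_def fillings_def RPP_def PiE_iff)
  moreover have "merge k D T (i, j) \<le> merge k D T (i, j')"
    if "(i, j) \<in> D" "(i, j') \<in> D" "j \<le> j'" for i j j'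
    unfolding m[OF that(1)] m[OF that(2)] by (rule mono[OF RPP_rowD[OF assms(1) that]])
  moreover have "merge k D T (i, j) \<le> merge k D T (i', j)"
    if "(i, j) \<in> D" "(i', j) \<in> D" "i \<le> i'" for i i' j
    unfolding m[OF that(1)] m[OF that(2)] by (rule mono[OF RPP_colD[OF assms(1) that]])
  ultimately show ?thesis unfolding RPP_def by blast
qed

text \<open>One class, with common merged filling \<open>S\<close>. As \<open>S\<close> avoids
  \<open>Suc k\<close>, every entry above \<open>k\<close> exceeds \<open>Suc k\<close>, which
  leaves room to raise entries \<open>k\<close> by one.\<close>

locale merged_rpp =
  fixes k :: nat and D :: "(nat \<times> nat) set" and S :: "nat \<times> nat \<Rightarrow> nat"
  assumes fin: "finite D" and conv: "convex_cells D"
    and S: "S \<in> RPP D" and S_ne: "c \<in> D \<Longrightarrow> S c \<noteq> Suc k"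
begin

abbreviation "R \<equiv> level k D S"
abbreviation "J \<equiv> snd ` R"
abbreviation "s \<equiv> first_row R"
abbreviation "e \<equiv> end_row R"

lemma finite_R: "finite R" and finite_J: "finite J"
  using fin by (auto simp: level_def)

lemma convex_R: "convex_cells R"
  unfolding convex_cells_def
proof (intro allI impI)
  fix i j i' j' r c
  assume *: "(i, j) \<in> R" "(i', j') \<in> R" "i \<le> r" "r \<le> i'" "j \<le> c" "c \<le> j'"
  then have D: "(i, j) \<in> D" "(i', j') \<in> D" by (auto simp: level_def)
  have rc: "(r, c) \<in> D" by (rule convex_cellsD[OF conv D *(3-)])
  then have "S (i, j) \<le> S (r, c)" "S (r, c) \<le> S (i', j')"
    using D *(3-) by (auto intro: RPP_mono[OF S conv])
  with rc * show "(r, c) \<in> R" by (auto simp: level_def)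
qed

lemma finite_col: "finite {r. (r, j) \<in> R}"
  by (rule finite_subset[OF _ finite_imageI[OF finite_R, of fst]]) force

text \<open>Convexity makes each column of \<open>R\<close> an interval, half-open because
  \<open>end_row\<close> is one past the last row.\<close>

lemma R_iff:
  assumes "j \<in> J"
  shows "(r, j) \<in> R \<longleftrightarrow> s j \<le> r \<and> r < e j"
proof -
  have ne: "{r. (r, j) \<in> R} \<noteq> {}" using assms by auto
  have "(s j, j) \<in> R" "(Max {r. (r, j) \<in> R}, j) \<in> R"
    using Min_in[OF finite_col ne] Max_in[OF finite_col ne] by (auto simp: first_row_def)
  then have "(r, j) \<in> R" if "s j \<le> r" "r \<le> Max {r. (r, j) \<in> R}"
    using convex_cellsD[OF convex_R _ _ that] by blast
  moreover have "s j \<le> r" "r \<le> Max {r. (r, j) \<in> R}" if "(r, j) \<in> R"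
    using that Min_le[OF finite_col] Max_ge[OF finite_col] by (simp_all add: first_row_def)
  ultimately show ?thesis
    unfolding end_row_def less_Suc_eq_le by blast
qed

lemma col_nonempty:
  assumes "j \<in> J"
  shows "s j < e j"
proof -
  obtain r where "(r, j) \<in> R" using assms by auto
  then show ?thesis using R_iff[OF assms] by auto
qed

text \<open>If \<open>s j < s j'\<close>, convexity would force \<open>(s j, j')\<close> into
  \<open>R\<close>, above the first row of its column. For \<open>antimono_end_row\<close> the
  offending cell is \<open>(e j' - 1, j)\<close>.\<close>

lemma antimono_first_row: "antimono_on J s"
proof (rule monotone_onI, rule ccontr)
  fix j j' assume j: "j \<in> J" "j' \<in> J" "j \<le> j'" and *: "\<not> s j' \<le> s j"
  have "(s j, j) \<in> R" "(s j', j') \<in> R"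
    using col_nonempty[OF j(1)] col_nonempty[OF j(2)] by (simp_all add: R_iff[OF j(1)] R_iff[OF j(2)])
  then have "(s j, j') \<in> R"
    by (rule convex_cellsD[OF convex_R]) (use j * in auto)
  with * show False by (simp add: R_iff[OF j(2)])
qed

lemma antimono_end_row: "antimono_on J e"
proof (rule monotone_onI, rule ccontr)
  fix j j' assume j: "j \<in> J" "j' \<in> J" "j \<le> j'" and *: "\<not> e j' \<le> e j"
  have "(e j - 1, j) \<in> R" "(e j' - 1, j') \<in> R"
    using col_nonempty[OF j(1)] col_nonempty[OF j(2)] by (auto simp: R_iff[OF j(1)] R_iff[OF j(2)])
  then have "(e j' - 1, j) \<in> R"
    by (rule convex_cellsD[OF convex_R]) (use j * in auto)
  with * col_nonempty[OF j(2)] show False by (auto simp: R_iff[OF j(1)])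
qed

lemma split_at_apply:
  "(r, j) \<in> D \<Longrightarrow> split_at k D S P (r, j) = (if S (r, j) = k \<and> P j \<le> r then Suc k else S (r, j))"
  by (simp add: split_at_def)

text \<open>As \<open>P\<close> is weakly decreasing, a raised \<open>k\<close> has only raised
  entries \<open>k\<close> to its right in its row; the threshold in rows gives the same down each
  column.\<close>

lemma split_at_RPP:
  assumes P: "P \<in> paths J s e"
  shows "split_at k D S P \<in> RPP D"
proof -
  let ?T = "split_at k D S P"
  have pos: "1 \<le> S c" if "c \<in> D" for c
    using S that by (auto simp: RPP_def fillings_def PiE_iff)
  have "?T \<in> fillings D"
    using pos by (auto simp: fillings_def split_at_def PiE_iff)
  moreover have "?T (i, j) \<le> ?T (i, j')" if "(i, j) \<in> D" "(i, j') \<in> D" "j \<le> j'" for i j j'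
  proof -
    have le: "S (i, j) \<le> S (i, j')" using S that by (rule RPP_rowD)
    have "P j' \<le> P j" if "S (i, j) = k" "S (i, j') = k"
    proof -
      have "j \<in> J" "j' \<in> J" using that \<open>(i, j) \<in> D\<close> \<open>(i, j') \<in> D\<close> by (force simp: level_def)+
      with P \<open>j \<le> j'\<close> show ?thesis by (auto simp: paths_def monotone_on_def)
    qed
    then show ?thesis
      using that le S_ne[OF that(2)] by (force simp: split_at_apply)
  qed
  moreover have "?T (i, j) \<le> ?T (i', j)" if "(i, j) \<in> D" "(i', j) \<in> D" "i \<le> i'" for i i' j
    using that RPP_colD[OF S that] S_ne[OF that(2)] by (force simp: split_at_apply)
  ultimately show ?thesis by (auto simp: RPP_def)
qed

lemma merge_split_at: "merge k D (split_at k D S P) = S"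
proof
  fix c
  show "merge k D (split_at k D S P) c = S c"
    using S S_ne by (cases c) (auto simp: merge_def split_at_def RPP_def fillings_def PiE_iff extensional_def)
qed

lemma merged_value: "merge k D T = S \<Longrightarrow> c \<in> D \<Longrightarrow> S c = (if T c = Suc k then k else T c)"
  by (auto simp: merge_def)

lemma split_values: "merge k D T = S \<Longrightarrow> c \<in> R \<Longrightarrow> T c = k \<or> T c = Suc k"
  using merged_value[of T c] by (auto simp: level_def split: if_splits)

text \<open>In a column of \<open>R\<close> the entries \<open>k\<close> precede the entries
  \<open>Suc k\<close>, so the latter form a bottom segment, and \<open>height\<close> is its
  start.\<close>

lemma height_le_iff:
  assumes T: "T \<in> RPP D" "merge k D T = S" and R: "(r, j) \<in> R"
  shows "height k R T j \<le> r \<longleftrightarrow> T (r, j) = Suc k"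
proof -
  let ?Q = "\<lambda>p. s j \<le> p \<and> (\<forall>r. p \<le> r \<longrightarrow> (r, j) \<in> R \<longrightarrow> T (r, j) = Suc k)"
  have j: "j \<in> J" using R by force
  then have "?Q (e j)" using R_iff col_nonempty by (simp add: less_imp_le)
  then have h: "?Q (height k R T j)" unfolding height_def by (rule LeastI)
  have "?Q r" if "T (r, j) = Suc k"
  proof (intro conjI allI impI)
    show "s j \<le> r" using R j by (simp add: R_iff)
    fix r' assume r': "r \<le> r'" "(r', j) \<in> R"
    then have D: "(r, j) \<in> D" "(r', j) \<in> D" "S (r', j) = k" using R by (auto simp: level_def)
    then have "T (r, j) \<le> T (r', j)" using RPP_colD[OF T(1) _ _ r'(1)] by blast
    moreover have "T (r', j) = k \<or> T (r', j) = Suc k"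
      using T(2) r'(2) by (rule split_values)
    ultimately show "T (r', j) = Suc k" using that by auto
  qed
  then have "height k R T j \<le> r" if "T (r, j) = Suc k"
    unfolding height_def using that by (intro Least_le) blast
  with h R show ?thesis by blast
qed

lemma height_bounds:
  assumes "j \<in> J"
  shows "s j \<le> height k R T j" "height k R T j \<le> e j"
proof -
  let ?Q = "\<lambda>p. s j \<le> p \<and> (\<forall>r. p \<le> r \<longrightarrow> (r, j) \<in> R \<longrightarrow> T (r, j) = Suc k)"
  have e: "?Q (e j)" using assms R_iff col_nonempty by (simp add: less_imp_le)
  show "s j \<le> height k R T j" unfolding height_def using LeastI[of ?Q, OF e] by blast
  show "height k R T j \<le> e j" unfolding height_def using Least_le[of ?Q, OF e] .
qed

lemma height_paths:
  assumes T: "T \<in> RPP D" "merge k D T = S"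
  shows "restrict (height k R T) J \<in> paths J s e"
proof -
  have "height k R T j' \<le> height k R T j" if j: "j \<in> J" "j' \<in> J" "j \<le> j'" for j j'
  proof (rule ccontr)
    let ?h = "height k R T j"
    assume *: "\<not> height k R T j' \<le> ?h"
    \<comment> \<open>Monotonicity of \<open>s\<close> and \<open>e\<close> ensures that row
      \<open>?h\<close> meets \<open>R\<close> in both columns; there \<open>Suc k\<close> would
      stand left of \<open>k\<close>.\<close>
    have "s j' \<le> s j" "e j' \<le> e j"
      using monotone_onD[OF antimono_first_row j] monotone_onD[OF antimono_end_row j] by auto
    then have "s j' \<le> ?h" "?h < e j'" "e j' \<le> e j"
      using * height_bounds[OF j(1), of T] height_bounds[OF j(2), of T] by linarith+
    then have R: "(?h, j) \<in> R" "(?h, j') \<in> R"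
      using j height_bounds[OF j(1)] by (auto simp: R_iff)
    then have "T (?h, j) = Suc k" "T (?h, j') \<noteq> Suc k"
      using height_le_iff[OF T R(1)] height_le_iff[OF T R(2)] * by auto
    moreover have "T (?h, j) \<le> T (?h, j')"
      using R j(3) RPP_rowD[OF T(1)] by (auto simp: level_def)
    moreover have "T (?h, j') = k \<or> T (?h, j') = Suc k"
      using T(2) R(2) by (rule split_values)
    ultimately show False by auto
  qed
  then show ?thesis
    using height_bounds by (auto simp: paths_def monotone_on_def)
qed

lemma split_at_height:
  assumes T: "T \<in> RPP D" "merge k D T = S"
  shows "split_at k D S (restrict (height k R T) J) = T"
proof
  fix c :: "nat \<times> nat"
  obtain r j where c: "c = (r, j)" by (cases c)
  show "split_at k D S (restrict (height k R T) J) c = T c"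
  proof (cases "c \<in> D")
    case False
    have "T \<in> extensional D" using T(1) by (simp add: RPP_def fillings_def PiE_iff)
    then have "T c = undefined" using False by (rule extensional_arb)
    with False show ?thesis by (simp add: split_at_def)
  next
    case D: True
    have Sc: "S c = (if T c = Suc k then k else T c)" using T(2) D by (rule merged_value)
    show ?thesis
    proof (cases "c \<in> R")
      case True
      then have "j \<in> J" using c by force
      with True D c Sc show ?thesis
        using height_le_iff[OF T, of r j] by (auto simp: split_at_apply level_def split: if_splits)
    next
      case False
      with D c Sc show ?thesis by (auto simp: split_at_apply level_def split: if_splits)
    qed
  qed
qed

lemma height_split_at:
  assumes P: "P \<in> paths J s e" and j: "j \<in> J"
  shows "height k R (split_at k D S P) j = P j"
proof -
  have Pj: "s j \<le> P j" "P j \<le> e j" using P j by (auto simp: paths_def PiE_iff)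
  \<comment> \<open>Two numbers between \<open>s j\<close> and \<open>e j\<close> agree if they
    compare alike with every row in the half-open interval.\<close>
  have iff: "height k R (split_at k D S P) j \<le> r \<longleftrightarrow> P j \<le> r" if "s j \<le> r" "r < e j" for r
  proof -
    have "(r, j) \<in> R" using j that by (simp add: R_iff)
    then show ?thesis
      using height_le_iff[OF split_at_RPP[OF P] merge_split_at, of r j]
      by (auto simp: split_at_apply level_def)
  qed
  show ?thesis
    using iff[of "P j"] iff[of "height k R (split_at k D S P) j"] Pj
      height_bounds[OF j, of "split_at k D S P"] by force
qed

lemma labels_split_at:
  "P \<in> paths J s e \<Longrightarrow> labels k D (split_at k D S P) = label_mset J s e P"
  unfolding labels_def merge_split_at Let_def label_mset_def
  using finite_J height_split_at by (intro image_mset_cong) simp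

text \<open>\<open>split_at\<close> and the restricted \<open>height\<close> are mutually inverse,
  and \<open>labels_split_at\<close> transports the label multiset.\<close>

lemma card_labels:
  "card {T \<in> RPP D. merge k D T = S \<and> labels k D T = M} = card {P \<in> paths J s e. label_mset J s e P = M}"
proof (rule bij_betw_same_card[symmetric], rule bij_betw_byWitness)
  let ?f = "split_at k D S" and ?g = "\<lambda>T. restrict (height k R T) J"
  have gf: "?g (?f P) = P" if "P \<in> paths J s e" for P
    using that height_split_at[OF that] by (auto simp: paths_def PiE_iff extensional_def fun_eq_iff)
  then show "\<forall>P\<in>{P \<in> paths J s e. label_mset J s e P = M}. ?g (?f P) = P" by blast
  show "\<forall>T\<in>{T \<in> RPP D. merge k D T = S \<and> labels k D T = M}. ?f (?g T) = T"
    using split_at_height by blast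
  show "?f ` {P \<in> paths J s e. label_mset J s e P = M} \<subseteq> {T \<in> RPP D. merge k D T = S \<and> labels k D T = M}"
    using split_at_RPP merge_split_at labels_split_at by auto
  show "?g ` {T \<in> RPP D. merge k D T = S \<and> labels k D T = M} \<subseteq> {P \<in> paths J s e. label_mset J s e P = M}"
    using height_paths split_at_height labels_split_at by fastforce
qed

text \<open>Entries are unbounded, so finiteness, needed to turn equal cardinalities into
  bijections, is sought class by class.\<close>

lemma finite_merge_fiber: "finite {T \<in> RPP D. merge k D T = S}"
proof (rule finite_subset)
  show "{T \<in> RPP D. merge k D T = S} \<subseteq> split_at k D S ` paths J s e"
  proof
    fix T assume "T \<in> {T \<in> RPP D. merge k D T = S}"
    then have T: "T \<in> RPP D" "merge k D T = S" by auto
    show "T \<in> split_at k D S ` paths J s e"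
      using split_at_height[OF T] height_paths[OF T] by (intro image_eqI) (rule sym)
  qed
  show "finite (split_at k D S ` paths J s e)"
    using finite_paths finite_J by blast
qed

lemma card_labels_swap:
  "card {T \<in> RPP D. merge k D T = S \<and> labels k D T = M} =
   card {T \<in> RPP D. merge k D T = S \<and> labels k D T = image_mset swap_label M}"
  unfolding card_labels
  by (rule card_paths_swap[OF finite_J antimono_first_row antimono_end_row col_nonempty])

section \<open>The statistics read off from the labels\<close>

lemma size_filter_labels:
  assumes "T \<in> RPP D" "merge k D T = S"
  shows "size (filter_mset Q (labels k D T)) = card {j \<in> J. Q (label_of (s j) (e j) (height k R T j))}"
  unfolding labels_def assms(2) Let_def label_mset_def using finite_J
  by (simp add: filter_mset_image_mset filter_mset_mset_set)

text \<open>A column contains \<open>k\<close> iff it meets \<open>R\<close> and does not consist of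
  \<open>Suc k\<close> throughout \<open>R\<close>; its first row in \<open>R\<close> is then a
  witness.\<close>

lemma ircont_low:
  assumes T: "T \<in> RPP D" "merge k D T = S"
  shows "ircont D T k = size {#a \<in># labels k D T. a \<noteq> Hi#}"
proof -
  have "(\<exists>r. (r, j) \<in> D \<and> T (r, j) = k) \<longleftrightarrow> j \<in> J \<and> label_of (s j) (e j) (height k R T j) \<noteq> Hi" for j
  proof
    assume "\<exists>r. (r, j) \<in> D \<and> T (r, j) = k"
    then obtain r where r: "(r, j) \<in> D" "T (r, j) = k" by blast
    then have "(r, j) \<in> R" using merged_value[OF T(2), of "(r, j)"] by (auto simp: level_def)
    moreover from this have "j \<in> J" by force
    ultimately show "j \<in> J \<and> label_of (s j) (e j) (height k R T j) \<noteq> Hi"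
      using height_le_iff[OF T, of r j] r by (auto simp: label_of_def R_iff)
  next
    assume *: "j \<in> J \<and> label_of (s j) (e j) (height k R T j) \<noteq> Hi"
    then have R: "(s j, j) \<in> R" using R_iff col_nonempty by blast
    then have "T (s j, j) \<noteq> Suc k"
      using * height_le_iff[OF T R] height_bounds[of j T] col_nonempty[of j] by (auto simp: label_of_def split: if_splits)
    with R split_values[OF T(2) R] show "\<exists>r. (r, j) \<in> D \<and> T (r, j) = k"
      by (auto simp: level_def)
  qed
  then show ?thesis by (simp add: ircont_def size_filter_labels[OF T])
qed

lemma ircont_high:
  assumes T: "T \<in> RPP D" "merge k D T = S"
  shows "ircont D T (Suc k) = size {#a \<in># labels k D T. a \<noteq> Lo#}"
proof -
  have "(\<exists>r. (r, j) \<in> D \<and> T (r, j) = Suc k) \<longleftrightarrow> j \<in> J \<and> label_of (s j) (e j) (height k R T j) \<noteq> Lo" for j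
  proof
    assume "\<exists>r. (r, j) \<in> D \<and> T (r, j) = Suc k"
    then obtain r where r: "(r, j) \<in> D" "T (r, j) = Suc k" by blast
    then have "(r, j) \<in> R" using merged_value[OF T(2), of "(r, j)"] by (auto simp: level_def)
    moreover from this have "j \<in> J" by force
    ultimately show "j \<in> J \<and> label_of (s j) (e j) (height k R T j) \<noteq> Lo"
      using height_le_iff[OF T, of r j] r by (auto simp: label_of_def R_iff)
  next
    let ?h = "height k R T j"
    assume *: "j \<in> J \<and> label_of (s j) (e j) ?h \<noteq> Lo"
    \<comment> \<open>The label is not \<open>Lo\<close>, so the height is a genuine row of the
      column, and that row carries \<open>Suc k\<close>.\<close>
    then have R: "(?h, j) \<in> R"
      using height_bounds[of j T] by (auto simp: R_iff label_of_def split: if_splits)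
    then show "\<exists>r. (r, j) \<in> D \<and> T (r, j) = Suc k"
      using height_le_iff[OF T R] by (auto simp: level_def)
  qed
  then show ?thesis by (simp add: ircont_def size_filter_labels[OF T])
qed

lemma ircont_other:
  assumes "merge k D T = S" "v \<noteq> k" "v \<noteq> Suc k"
  shows "ircont D T v = ircont D S v"
proof -
  have "T c = v \<longleftrightarrow> S c = v" if "c \<in> D" for c
    using assms merged_value[OF assms(1) that] by auto
  then show ?thesis by (auto simp: ircont_def intro!: arg_cong[where f = card])
qed

text \<open>Merging creates a vertical equality exactly where \<open>k\<close> stands directly above
  \<open>Suc k\<close>, that is, where the height is \<open>Suc r\<close> and rows \<open>r\<close>
  and \<open>Suc r\<close> both lie in \<open>R\<close>.\<close>

lemma ceq_eq:
  assumes T: "T \<in> RPP D" "merge k D T = S"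
  shows "ceq D T r = ceq D S r - size {#a \<in># labels k D T. a = Mixed (Suc r)#}"
proof -
  let ?E = "\<lambda>T. {j. (r, j) \<in> D \<and> (r + 1, j) \<in> D \<and> T (r, j) = T (r + 1, j)}"
  let ?M = "{j \<in> J. label_of (s j) (e j) (height k R T j) = Mixed (Suc r)}"
  have M: "j \<in> ?M \<longleftrightarrow> (r, j) \<in> R \<and> (Suc r, j) \<in> R \<and> height k R T j = Suc r" for j
  proof (cases "j \<in> J")
    case True
    then show ?thesis
      using height_bounds[OF True, of T] by (auto simp: label_of_def R_iff split: if_splits)
  qed force
  note TS = merged_value[OF T(2)]
  have "?E T = ?E S - ?M"
  proof (intro set_eqI)
    fix j
    show "j \<in> ?E T \<longleftrightarrow> j \<in> ?E S - ?M"
    proof (cases "(r, j) \<in> R \<and> (Suc r, j) \<in> R")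
      case True
      then have D: "(r, j) \<in> D" "(Suc r, j) \<in> D" "S (r, j) = k" "S (Suc r, j) = k"
        by (auto simp: level_def)
      show ?thesis
        unfolding Diff_iff M
        using True D TS[OF D(1)] TS[OF D(2)] height_le_iff[OF T, of r j] height_le_iff[OF T, of "Suc r" j]
        by (auto simp: le_Suc_eq split: if_splits)
    next
      case False
      have "T (r, j) = T (Suc r, j) \<longleftrightarrow> S (r, j) = S (Suc r, j)"
        if D: "(r, j) \<in> D" "(Suc r, j) \<in> D"
      proof -
        have "\<not> (S (r, j) = k \<and> S (Suc r, j) = k)" using False D by (simp add: level_def)
        then show ?thesis unfolding TS[OF D(1)] TS[OF D(2)] by presburger
      qed
      with False show ?thesis unfolding Diff_iff M by auto
    qed
  qed
  \<comment> \<open>This inclusion makes the cardinality of the difference equal to the difference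
    on \<open>nat\<close>.\<close>
  moreover have "?M \<subseteq> ?E S" unfolding subset_iff M by (auto simp: level_def)
  moreover have "finite ?M" using finite_J by simp
  ultimately show ?thesis
    by (simp add: ceq_def size_filter_labels[OF T] card_Diff_subset)
qed

end

lemma merged_rpp_merge:
  assumes "finite D" "convex_cells D" "1 \<le> k" "T \<in> RPP D"
  shows "merged_rpp k D (merge k D T)"
  using assms merge_RPP by unfold_locales (auto simp: merge_def)

subsection \<open>The involution\<close>

text \<open>Fibres over \<open>c\<close> and \<open>\<tau> c\<close> are exchanged by an arbitrary
  bijection and its inverse; if \<open>\<tau> c = c\<close>, the identity works.\<close>

lemma involution_from_card:
  assumes tau: "\<And>c. \<tau> (\<tau> c) = c"
    and fin: "\<And>c. finite {t \<in> X. \<kappa> t = c}"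
    and card: "\<And>c. card {t \<in> X. \<kappa> t = c} = card {t \<in> X. \<kappa> t = \<tau> c}"
  shows "\<exists>f. \<forall>t\<in>X. f t \<in> X \<and> f (f t) = t \<and> \<kappa> (f t) = \<tau> (\<kappa> t)"
proof -
  \<comment> \<open>\<open>Q c\<close> and \<open>Q (\<tau> c)\<close> are the same predicate, so \<open>SOME f. Q c f\<close> is the same map on both fibres.\<close>
  define Q where "Q c f \<longleftrightarrow> (\<forall>t\<in>X. \<kappa> t \<in> {c, \<tau> c} \<longrightarrow> f t \<in> X \<and> f (f t) = t \<and> \<kappa> (f t) = \<tau> (\<kappa> t))" for c f
  have Q_tau: "Q (\<tau> c) = Q c" for c
    unfolding Q_def by (simp add: tau insert_commute)
  have "\<exists>f. Q c f" for c
  proof (cases "\<tau> c = c")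
    case True
    then show ?thesis by (intro exI[of _ id]) (auto simp: Q_def)
  next
    case False
    obtain g where g: "bij_betw g {t \<in> X. \<kappa> t = c} {t \<in> X. \<kappa> t = \<tau> c}"
      using finite_same_card_bij[OF fin fin card] by blast
    let ?h = "inv_into {t \<in> X. \<kappa> t = c} g"
    have h: "bij_betw ?h {t \<in> X. \<kappa> t = \<tau> c} {t \<in> X. \<kappa> t = c}"
      using g by (rule bij_betw_inv_into)
    have "g t \<in> X \<and> \<kappa> (g t) = \<tau> c \<and> ?h (g t) = t" if "t \<in> X" "\<kappa> t = c" for t
      using bij_betwE[OF g] bij_betw_inv_into_left[OF g] that by auto
    moreover have "?h t \<in> X \<and> \<kappa> (?h t) = c \<and> g (?h t) = t" if "t \<in> X" "\<kappa> t = \<tau> c" for t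
      using bij_betwE[OF h] bij_betw_inv_into_right[OF g] that by auto
    ultimately have "Q c (\<lambda>t. if \<kappa> t = c then g t else ?h t)"
      using False tau by (auto simp: Q_def)
    then show ?thesis by blast
  qed
  then have Q: "Q c (SOME f. Q c f)" for c by (rule someI_ex)
  have inv: "(SOME f. Q (\<tau> c) f) = (SOME f. Q c f)" for c by (simp add: Q_tau)
  show ?thesis
  proof (intro exI[of _ "\<lambda>t. (SOME f. Q (\<kappa> t) f) t"] ballI)
    fix t assume t: "t \<in> X"
    show "(SOME f. Q (\<kappa> t) f) t \<in> X \<and>
      (SOME f. Q (\<kappa> ((SOME f. Q (\<kappa> t) f) t)) f) ((SOME f. Q (\<kappa> t) f) t) = t \<and>
      \<kappa> ((SOME f. Q (\<kappa> t) f) t) = \<tau> (\<kappa> t)"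
      using Q[of "\<kappa> t"] t by (auto simp: Q_def[of "\<kappa> t" "SOME f. Q (\<kappa> t) f"] inv)
  qed
qed

theorem theorem3p4:
  fixes l \<mu> :: "nat \<Rightarrow> nat" and i :: nat
  assumes "skew_partition l \<mu>" and "i \<ge> 1"
  shows "\<exists>B. B \<in> RPP (skew_diagram l \<mu>) \<rightarrow> RPP (skew_diagram l \<mu>) \<and>
    (\<forall>T \<in> RPP (skew_diagram l \<mu>). B (B T) = T) \<and>
    (\<forall>T \<in> RPP (skew_diagram l \<mu>). ceq (skew_diagram l \<mu>) (B T) = ceq (skew_diagram l \<mu>) T) \<and>
    (\<forall>T \<in> RPP (skew_diagram l \<mu>). ircont (skew_diagram l \<mu>) (B T) = ircont (skew_diagram l \<mu>) T \<circ> transpose i (i + 1))"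
proof -
  define D where "D = skew_diagram l \<mu>"
  have merged: "merged_rpp i D (merge i D T)" if "T \<in> RPP D" for T
    using merged_rpp_merge finite_skew_diagram convex_skew_diagram assms that unfolding D_def by blast
  let ?\<kappa> = "\<lambda>T. (merge i D T, labels i D T)"
  let ?\<tau> = "\<lambda>(S, M). (S, image_mset swap_label M)"
  have "\<exists>B. \<forall>T\<in>RPP D. B T \<in> RPP D \<and> B (B T) = T \<and> ?\<kappa> (B T) = ?\<tau> (?\<kappa> T)"
  proof (rule involution_from_card)
    show "?\<tau> (?\<tau> c) = c" for c :: "(nat \<times> nat \<Rightarrow> nat) \<times> label multiset"
      by (cases c) (simp add: image_mset.compositionality comp_def)
    fix c :: "(nat \<times> nat \<Rightarrow> nat) \<times> label multiset"
    obtain S M where c: "c = (S, M)" by (cases c)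
    \<comment> \<open>If \<open>S\<close> is not the merge of any rpp, the fibre is empty; otherwise
      \<open>merged_rpp\<close> applies.\<close>
    show "finite {T \<in> RPP D. ?\<kappa> T = c}"
    proof (cases "\<exists>T\<in>RPP D. merge i D T = S")
      case True
      then show ?thesis
        using merged_rpp.finite_merge_fiber[of i D S] merged c by (auto elim!: rev_finite_subset)
    next
      case False
      then have "{T \<in> RPP D. ?\<kappa> T = c} = {}" using c by auto
      then show ?thesis by (metis finite.emptyI)
    qed
    show "card {T \<in> RPP D. ?\<kappa> T = c} = card {T \<in> RPP D. ?\<kappa> T = ?\<tau> c}"
    proof (cases "\<exists>T\<in>RPP D. merge i D T = S")
      case True
      then show ?thesis
        using merged_rpp.card_labels_swap[of i D S M] merged c by auto
    next
      case False
      then have "{T \<in> RPP D. ?\<kappa> T = c} = {}" "{T \<in> RPP D. ?\<kappa> T = ?\<tau> c} = {}" using c by auto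
      then show ?thesis by metis
    qed
  qed
  then obtain B where B: "\<And>T. T \<in> RPP D \<Longrightarrow> B T \<in> RPP D \<and> B (B T) = T \<and>
      merge i D (B T) = merge i D T \<and> labels i D (B T) = image_mset swap_label (labels i D T)"
    by auto
  \<comment> \<open>\<open>ceq\<close> depends on the \<open>Mixed\<close> labels, which
    \<open>swap_label\<close> fixes; the two \<open>ircont\<close> formulas count labels other than
    \<open>Hi\<close> and other than \<open>Lo\<close>, which it exchanges.\<close>
  have eqs: "swap_label a \<noteq> Hi \<longleftrightarrow> a \<noteq> Lo" "swap_label a \<noteq> Lo \<longleftrightarrow> a \<noteq> Hi"
    "swap_label a = Mixed q \<longleftrightarrow> a = Mixed q" for a q
    by (cases a; simp)+
  have "ceq D (B T) = ceq D T" if T: "T \<in> RPP D" for T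
    using merged_rpp.ceq_eq[OF merged[OF T], of T] merged_rpp.ceq_eq[OF merged[OF T], of "B T"] B[OF T] T
    by (simp add: fun_eq_iff filter_mset_image_mset eqs)
  moreover have "ircont D (B T) = ircont D T \<circ> transpose i (i + 1)" if T: "T \<in> RPP D" for T
  proof
    fix v
    note L = merged_rpp.ircont_low[OF merged[OF T]] merged_rpp.ircont_high[OF merged[OF T]]
      merged_rpp.ircont_other[OF merged[OF T]]
    consider "v = i" | "v = Suc i" | "v \<noteq> i" "v \<noteq> Suc i" by blast
    then show "ircont D (B T) v = (ircont D T \<circ> transpose i (i + 1)) v"
      using L(1,2)[of T] L(1,2)[of "B T"] L(3)[of T v] L(3)[of "B T" v] B[OF T] T
      by cases (simp_all add: filter_mset_image_mset eqs transpose_apply_other)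
  qed
  ultimately show ?thesis
    using B unfolding D_def by (intro exI[of _ B]) blast
qed

end
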